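(* Let $f:(\mathbb{R}^n\setminus\mathcal{C})\times U\to\mathbb{R}^n$ be continuous and satisfy hypothesis $(\mathrm{Hg})$ stated in the context, with associated rescaled dynamics $\bar f$, extended dynamics $F$ and extended control set $\overline{\mathbb{U}}$. A map $W:\overline{\mathbb{R}^n\setminus\mathcal{C}}\to[0,+\infty)$ is a control Lyapunov function (CLF) for the rescaled system $y'=\bar f(y,v)$, $v\in U$, if and only if it is a CLF for the extended system $y'=F(y,w_0,w)$, $(w_0,w)\in\overline{\mathbb{U}}$.
   Context: Standing setting. $\mathcal{C}\subset\mathbb{R}^n$ is a nonempty closed set with compact boundary, $U\subseteq\mathbb{R}^m$ is a closed cone, and $B_R(\mathcal{C}):=\{x\in\mathbb{R}^n:\mathrm{dist}(x,\mathcal{C})\le R\}$. Hypothesis $(\mathrm{Hg})$. There is a strictly increasing bijection $\nu:[0,+\infty)\to[0,+\infty)$ (growth rate) such that: (i) $\bar f(x,u):=\frac{f(x,u)}{1+\nu(|u|)}$ is uniformly continuous on $\mathcal{K}\times U$ for every compact $\mathcal{K}\subset\mathbb{R}^n\setminus\mathcal{C}$, and bounded on $(B_R(\mathcal{C})\setminus\mathcal{C})\times U$ for every $R>0$; (ii) letting $\mathbb{U}:=\{(w_0,w)\in(0,+\infty)\times U:\ w_0+|w|=1\}$ and $\overline{\mathbb{U}}$ its closure, the extended dynamics $$F(x,w_0,w):=\lim_{r\to w_0^+}\bar f\Big(x,\tfrac{w}{|w|}\,\nu^{-1}\big(\tfrac{|w|}{r}\big)\Big)=\lim_{r\to w_0^+}f\Big(x,\tfrac{w}{|w|}\,\nu^{-1}\big(\tfrac{|w|}{r}\big)\Big)\,r$$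 (with $\frac{w}{|w|}:=0$ if $w=0$; extended by continuity to $x\in\partial(\mathbb{R}^n\setminus\mathcal{C})$) is well defined, not identically zero, continuous and locally bounded on $\overline{(\mathbb{R}^n\setminus\mathcal{C})}\times\overline{\mathbb{U}}$. CLF. For a nonempty closed set $V\subseteq\mathbb{R}^M$ and a continuous $g:(\mathbb{R}^n\setminus\mathcal{C})\times V\to\mathbb{R}^n$, let $H_{g,V}(x,p):=\inf_{u\in V}\langle p,g(x,u)\rangle\in[-\infty,+\infty)$. For $x\in\mathbb{R}^n\setminus\mathcal{C}$, $p\in\partial_PW(x)$ (proximal subdifferential) iff there are $\sigma,\eta>0$ with $W(y)-W(x)+\sigma|y-x|^2\ge\langle p,y-x\rangle$ for all $y$ with $|y-x|\le\eta$; $\partial_LW(x):=\{\lim_i p_i:\ p_i\in\partial_PW(x_i),\ x_i\to x\}$ (limiting subdifferential). A CLF for $\dot x=g(x,u)$, $u\in V$, is a locally Lipschitz function $W:\overline{\mathbb{R}^n\setminus\mathcal{C}}\to[0,+\infty)$ that is positive definite ($W>0$ on $\mathbb{R}^n\setminus\mathcal{C}$, $W=0$ on $\partial(\mathbb{R}^n\setminus\mathcal{C})$) and proper (preimages of compact subsets of $[0,+\infty)$ are compact), such that for some continuous, strictly increasing $\gamma:(0,+\infty)\to(0,+\infty)$ one has $H_{g,V}(x,p)<-\gamma(W(x))$ for all $x\in\mathbb{R}^n\setminus\mathcal{C}$ and all $p\in\partial_LW(x)$. *)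

theory Defs
  imports "HOL-Analysis.Analysis"
begin

text \<open>
  The state constraint is the open set \<open>- C\<close>. Functions that the mathematics defines only on
  \<open>(- C) \<times> V\<close> or on \<open>closure (- C)\<close> are total here; their values elsewhere are never used.
\<close>

definition tube :: "real \<Rightarrow> 'a::euclidean_space set \<Rightarrow> 'a set"
  where "tube R C = {x. infdist x C \<le> R}"

definition growth_rate :: "(real \<Rightarrow> real) \<Rightarrow> bool"
  where "growth_rate \<nu> \<longleftrightarrow> strict_mono_on {0..} \<nu> \<and> bij_betw \<nu> {0..} {0..}"

definition rescaled ::
    "(real \<Rightarrow> real) \<Rightarrow> ('a::euclidean_space \<Rightarrow> 'b::euclidean_space \<Rightarrow> 'a) \<Rightarrow> 'a \<Rightarrow> 'b \<Rightarrow> 'a"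
  where "rescaled \<nu> f x u = f x u /\<^sub>R (1 + \<nu> (norm u))"

definition ext_controls :: "'b::euclidean_space set \<Rightarrow> (real \<times> 'b) set"
  where "ext_controls U = {(w0, w). w0 > 0 \<and> w \<in> U \<and> w0 + norm w = 1}"

text \<open>Since \<open>sgn w = w /\<^sub>R norm w\<close> and \<open>sgn 0 = 0\<close>, the convention for \<open>w = 0\<close> is built in.\<close>

definition ctrl :: "(real \<Rightarrow> real) \<Rightarrow> 'b::euclidean_space \<Rightarrow> real \<Rightarrow> 'b"
  where "ctrl \<nu> w r = inv_into {0..} \<nu> (norm w / r) *\<^sub>R sgn w"

definition ext_int ::
    "(real \<Rightarrow> real) \<Rightarrow> ('a::euclidean_space \<Rightarrow> 'b::euclidean_space \<Rightarrow> 'a) \<Rightarrow> 'a \<Rightarrow> real \<times> 'b \<Rightarrow> 'a"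
  where "ext_int \<nu> f x = (\<lambda>(w0, w). Lim (at_right w0) (\<lambda>r. rescaled \<nu> f x (ctrl \<nu> w r)))"

definition ext_dyn ::
    "'a::euclidean_space set \<Rightarrow> (real \<Rightarrow> real) \<Rightarrow> ('a \<Rightarrow> 'b::euclidean_space \<Rightarrow> 'a) \<Rightarrow>
      'a \<Rightarrow> real \<times> 'b \<Rightarrow> 'a"
  where "ext_dyn C \<nu> f x \<omega> =
    (if x \<in> - C then ext_int \<nu> f x \<omega> else Lim (at x within - C) (\<lambda>y. ext_int \<nu> f y \<omega>))"

text \<open>Existence of the limits that \<^const>\<open>ext_int\<close> and \<^const>\<open>ext_dyn\<close> select.\<close>

definition ext_dyn_well_defined ::
    "'a::euclidean_space set \<Rightarrow> 'b::euclidean_space set \<Rightarrow> (real \<Rightarrow> real) \<Rightarrow>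
      ('a \<Rightarrow> 'b \<Rightarrow> 'a) \<Rightarrow> bool"
  where "ext_dyn_well_defined C U \<nu> f \<longleftrightarrow>
    (\<forall>x \<in> - C. \<forall>(w0, w) \<in> closure (ext_controls U).
       \<exists>l. ((\<lambda>r. rescaled \<nu> f x (ctrl \<nu> w r)) \<longlongrightarrow> l) (at_right w0)) \<and>
    (\<forall>x \<in> frontier (- C). \<forall>\<omega> \<in> closure (ext_controls U).
       \<exists>l. ((\<lambda>y. ext_int \<nu> f y \<omega>) \<longlongrightarrow> l) (at x within - C))"

definition locally_bounded_on :: "'a::metric_space set \<Rightarrow> ('a \<Rightarrow> 'b::metric_space) \<Rightarrow> bool"
  where "locally_bounded_on S g \<longleftrightarrow> (\<forall>z\<in>S. \<exists>e>0. bounded (g ` (ball z e \<inter> S)))"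

definition Hg ::
    "'a::euclidean_space set \<Rightarrow> 'b::euclidean_space set \<Rightarrow> (real \<Rightarrow> real) \<Rightarrow>
      ('a \<Rightarrow> 'b \<Rightarrow> 'a) \<Rightarrow> bool"
  where "Hg C U \<nu> f \<longleftrightarrow>
    growth_rate \<nu> \<and>
    (\<forall>K. compact K \<and> K \<subseteq> - C \<longrightarrow>
       uniformly_continuous_on (K \<times> U) (\<lambda>(x, u). rescaled \<nu> f x u)) \<and>
    (\<forall>R>0. bounded ((\<lambda>(x, u). rescaled \<nu> f x u) ` ((tube R C - C) \<times> U))) \<and>
    ext_dyn_well_defined C U \<nu> f \<and>
    (\<exists>x \<in> closure (- C). \<exists>\<omega> \<in> closure (ext_controls U). ext_dyn C \<nu> f x \<omega> \<noteq> 0) \<and>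
    continuous_on (closure (- C) \<times> closure (ext_controls U)) (\<lambda>(x, \<omega>). ext_dyn C \<nu> f x \<omega>) \<and>
    locally_bounded_on (closure (- C) \<times> closure (ext_controls U)) (\<lambda>(x, \<omega>). ext_dyn C \<nu> f x \<omega>)"

definition hamiltonian ::
    "('a::euclidean_space \<Rightarrow> 'v \<Rightarrow> 'a) \<Rightarrow> 'v set \<Rightarrow> 'a \<Rightarrow> 'a \<Rightarrow> ereal"
  where "hamiltonian g V x p = (INF u\<in>V. ereal (p \<bullet> g x u))"

definition prox_subdiff :: "'a::euclidean_space set \<Rightarrow> ('a \<Rightarrow> real) \<Rightarrow> 'a \<Rightarrow> 'a set"
  where "prox_subdiff C W x =
    {p. \<exists>\<sigma>>0. \<exists>\<eta>>0. \<forall>y \<in> closure (- C). norm (y - x) \<le> \<eta> \<longrightarrow>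
          W y - W x + \<sigma> * (norm (y - x))\<^sup>2 \<ge> p \<bullet> (y - x)}"

definition lim_subdiff :: "'a::euclidean_space set \<Rightarrow> ('a \<Rightarrow> real) \<Rightarrow> 'a \<Rightarrow> 'a set"
  where "lim_subdiff C W x =
    {p. \<exists>xs ps. (\<forall>i::nat. xs i \<in> - C \<and> ps i \<in> prox_subdiff C W (xs i)) \<and>
          xs \<longlonglongrightarrow> x \<and> ps \<longlonglongrightarrow> p}"

definition locally_lipschitz_on :: "'a::metric_space set \<Rightarrow> ('a \<Rightarrow> 'b::metric_space) \<Rightarrow> bool"
  where "locally_lipschitz_on S W \<longleftrightarrow> (\<forall>x\<in>S. \<exists>e>0. \<exists>L. L-lipschitz_on (ball x e \<inter> S) W)"

definition is_CLF ::
    "'a::euclidean_space set \<Rightarrow> ('a \<Rightarrow> 'v \<Rightarrow> 'a) \<Rightarrow> 'v set \<Rightarrow> ('a \<Rightarrow> real) \<Rightarrow> bool"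
  where "is_CLF C g V W \<longleftrightarrow>
    W \<in> closure (- C) \<rightarrow> {0..} \<and>
    locally_lipschitz_on (closure (- C)) W \<and>
    (\<forall>x \<in> - C. W x > 0) \<and> (\<forall>x \<in> frontier (- C). W x = 0) \<and>
    (\<forall>K \<subseteq> {0..}. compact K \<longrightarrow> compact {x \<in> closure (- C). W x \<in> K}) \<and>
    (\<exists>\<gamma>::real \<Rightarrow> real. \<gamma> \<in> {0<..} \<rightarrow> {0<..} \<and> continuous_on {0<..} \<gamma> \<and> strict_mono_on {0<..} \<gamma> \<and>
       (\<forall>x \<in> - C. \<forall>p \<in> lim_subdiff C W x. hamiltonian g V x p < ereal (- \<gamma> (W x))))"

text \<open>
  The second expression for the extended dynamics, with \<open>r *\<^sub>R f x u\<close> in place of the rescaled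
  dynamics, has the same limits on \<open>closure (ext_controls U)\<close>.
\<close>

lemma closure_ext_controls_norm:
  fixes U :: "'b::euclidean_space set"
  assumes "(w0, w) \<in> closure (ext_controls U)"
  shows "w0 \<ge> 0" "w0 + norm w = 1"
proof -
  let ?S = "{\<omega>::real \<times> 'b. 0 \<le> fst \<omega>} \<inter> {\<omega>. fst \<omega> + norm (snd \<omega>) = 1}"
  have "closed ?S"
    by (intro closed_Int closed_Collect_le closed_Collect_eq continuous_intros)
  moreover have "ext_controls U \<subseteq> ?S"
    by (auto simp: ext_controls_def)
  ultimately have "(w0, w) \<in> ?S"
    using assms closure_minimal by blast
  then show "w0 \<ge> 0" "w0 + norm w = 1" by auto
qed

lemma ext_limit_alt:
  fixes f :: "'a::euclidean_space \<Rightarrow> 'b::euclidean_space \<Rightarrow> 'a"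
  assumes \<nu>: "growth_rate \<nu>" and w: "(w0, w) \<in> closure (ext_controls U)"
  shows "((\<lambda>r. rescaled \<nu> f x (ctrl \<nu> w r)) \<longlongrightarrow> l) (at_right w0) \<longleftrightarrow>
         ((\<lambda>r. r *\<^sub>R f x (ctrl \<nu> w r)) \<longlongrightarrow> l) (at_right w0)"
    (is "(?A \<longlongrightarrow> l) _ \<longleftrightarrow> (?B \<longlongrightarrow> l) _")
proof -
  note w0 = closure_ext_controls_norm[OF w]
  have eq: "?B r = (r + norm w) *\<^sub>R ?A r" if "r > w0" for r
  proof -
    have r: "r > 0" using that w0 by simp
    have surj: "\<nu> ` {0..} = {0..}" and inj: "inj_on \<nu> {0..}"
      using \<nu> by (auto simp: growth_rate_def bij_betw_def)
    have q: "norm w / r \<in> \<nu> ` {0..}" using r by (simp add: surj)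
    define s where "s = inv_into {0..} \<nu> (norm w / r)"
    have s: "s \<ge> 0" "\<nu> s = norm w / r"
      using inv_into_into[OF q] f_inv_into_f[OF q] by (auto simp: s_def)
    have "s = 0" if "w = 0"
    proof -
      obtain t where t: "t \<ge> 0" "\<nu> t = 0" using surj by (metis atLeast_iff imageE order_refl)
      have "\<nu> 0 \<ge> 0" using surj by (metis atLeast_iff imageI order_refl)
      moreover have "\<nu> 0 < \<nu> t" if "t > 0"
        using \<nu> that by (auto simp: growth_rate_def strict_mono_on_def)
      ultimately have "t = 0" using t by force
      then show "s = 0" using inj s t that by (auto simp: inj_on_def)
    qed
    then have "norm (ctrl \<nu> w r) = s"
      using s by (auto simp: ctrl_def s_def[symmetric] norm_sgn)
    then have "?A r = f x (ctrl \<nu> w r) /\<^sub>R (1 + norm w / r)"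
      by (simp add: rescaled_def s)
    moreover have "(r + norm w) * inverse (1 + norm w / r) = r"
    proof -
      have "r + norm w > 0" "1 + norm w / r > 0" using r by (auto intro: add_pos_nonneg)
      then show ?thesis using r by (simp add: field_simps)
    qed
    ultimately show ?thesis by simp
  qed
  have ev: "\<forall>\<^sub>F r in at_right w0. r > w0"
    by (simp add: eventually_at_filter)
  have lim: "((\<lambda>r. r + norm w) \<longlongrightarrow> 1) (at_right w0)"
    using w0 by (auto intro!: tendsto_eq_intros)
  show ?thesis
  proof
    assume "(?A \<longlongrightarrow> l) (at_right w0)"
    from tendsto_scaleR[OF lim this]
    have "((\<lambda>r. (r + norm w) *\<^sub>R ?A r) \<longlongrightarrow> l) (at_right w0)" by simp
    then show "(?B \<longlongrightarrow> l) (at_right w0)"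
      by (rule Lim_transform_eventually) (use ev in eventually_elim, simp add: eq)
  next
    assume B: "(?B \<longlongrightarrow> l) (at_right w0)"
    have "((\<lambda>r. inverse (r + norm w)) \<longlongrightarrow> 1) (at_right w0)"
      using tendsto_inverse[OF lim] by simp
    from tendsto_scaleR[OF this B]
    have "((\<lambda>r. inverse (r + norm w) *\<^sub>R ?B r) \<longlongrightarrow> l) (at_right w0)" by simp
    then show "(?A \<longlongrightarrow> l) (at_right w0)"
    proof (rule Lim_transform_eventually)
      show "\<forall>\<^sub>F r in at_right w0. inverse (r + norm w) *\<^sub>R ?B r = ?A r"
        using ev
      proof eventually_elim
        case (elim r)
        then have "r + norm w > 0" using w0 by (simp add: add_pos_nonneg)
        then show ?case unfolding eq[OF elim] by simp
      qed
    qed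
  qed
qed

end

theory Submission
  imports Defs
begin

text \<open>
  The map \<open>(w0, w) \<mapsto> ctrl \<nu> w w0\<close> is onto \<open>U\<close> from the controls with \<open>w0 > 0\<close>, and there
  \<open>F(x, w0, w)\<close> is the value of the rescaled dynamics at the corresponding control. Hence both
  systems have the same velocity set up to closure, so the same Hamiltonian, and the subgradient
  condition is the only part of the definition of a CLF that depends on the dynamics.
\<close>

text \<open>A positive preimage of 0 would force \<open>\<nu> 0 < 0\<close>, outside the range
  \<open>{0..}\<close>. This makes zero controls correspond to zero controls.\<close>

lemma growth_rate_zero:
  assumes "growth_rate \<nu>"
  shows "\<nu> 0 = 0"
proof -
  have surj: "\<nu> ` {0..} = {0..}" and mono: "strict_mono_on {0..} \<nu>"
    using assms by (auto simp: growth_rate_def bij_betw_def)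
  obtain t where t: "t \<ge> 0" "\<nu> t = 0"
    using surj by (metis atLeast_iff imageE order_refl)
  have "\<nu> 0 \<ge> 0"
    using surj by (metis atLeast_iff imageI order_refl)
  moreover have "\<nu> 0 < \<nu> t" if "t > 0"
    using mono that by (auto simp: strict_mono_on_def)
  ultimately show ?thesis
    using t by force
qed

lemma growth_rate_inv:
  assumes "growth_rate \<nu>"
  shows "inv_into {0..} \<nu> 0 = 0"
    and "s \<ge> 0 \<Longrightarrow> inv_into {0..} \<nu> s \<ge> 0"
    and "s \<ge> 0 \<Longrightarrow> \<nu> (inv_into {0..} \<nu> s) = s"
    and "t \<ge> 0 \<Longrightarrow> inv_into {0..} \<nu> (\<nu> t) = t"
    and "t \<ge> 0 \<Longrightarrow> \<nu> t \<ge> 0"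
proof -
  have surj: "\<nu> ` {0..} = {0..}" and inj: "inj_on \<nu> {0..}"
    using assms by (auto simp: growth_rate_def bij_betw_def)
  show *: "inv_into {0..} \<nu> (\<nu> t) = t" if "t \<ge> 0" for t
    using inj that by simp
  show "inv_into {0..} \<nu> 0 = 0"
    using *[of 0] growth_rate_zero[OF assms] by simp
  show "inv_into {0..} \<nu> s \<ge> 0" if "s \<ge> 0"
    using inv_into_into[of s \<nu> "{0..}"] surj that by auto
  show "\<nu> (inv_into {0..} \<nu> s) = s" if "s \<ge> 0"
    using f_inv_into_f[of s \<nu> "{0..}"] surj that by auto
  show "\<nu> t \<ge> 0" if "t \<ge> 0"
    using surj that by auto
qed

text \<open>Continuity comes from order alone: a monotone real function with open image cannot
  jump.\<close>

lemma continuous_on_growth_rate_inv: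
  assumes "growth_rate \<nu>"
  shows "continuous_on {0<..} (inv_into {0..} \<nu>)"
proof (rule continuous_onI_mono)
  let ?g = "inv_into {0..} \<nu>"
  note inv = growth_rate_inv[OF assms]
  have mono: "strict_mono_on {0..} \<nu>"
    using assms by (simp add: growth_rate_def)
  \<comment> \<open>The image is shown to be the open half-line. With 0 in the domain it would be
    \<open>{0..}\<close>, which is not open.\<close>
  have "?g s > 0" if "s > 0" for s
  proof -
    have "?g s \<noteq> 0"
      using inv(3)[of s] growth_rate_zero[OF assms] that by auto
    then show ?thesis
      using inv(2)[of s] that by simp
  qed
  moreover have "t \<in> ?g ` {0<..}" if "t > 0" for t
  proof
    show "t = ?g (\<nu> t)" using inv(4) that by simp
    have "\<nu> 0 < \<nu> t" using mono that by (auto simp: strict_mono_on_def)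
    then show "\<nu> t \<in> {0<..}" using growth_rate_zero[OF assms] by simp
  qed
  ultimately have "?g ` {0<..} = {0<..}" by auto
  then show "open (?g ` {0<..})" by simp
  show "?g s \<le> ?g t" if "s \<in> {0<..}" "t \<in> {0<..}" "s \<le> t" for s t
  proof (rule ccontr)
    assume "\<not> ?thesis"
    then have "\<nu> (?g t) < \<nu> (?g s)"
      using mono inv(2)[of s] inv(2)[of t] that by (auto simp: strict_mono_on_def)
    then show False using inv(3)[of s] inv(3)[of t] that by simp
  qed
qed

lemma ctrl_in_cone:
  assumes "growth_rate \<nu>" and "cone U" and "w \<in> U" and "r > 0"
  shows "ctrl \<nu> w r \<in> U"
proof -
  have "ctrl \<nu> w r = (inv_into {0..} \<nu> (norm w / r) * inverse (norm w)) *\<^sub>R w"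
    by (simp add: ctrl_def sgn_div_norm)
  moreover have "inv_into {0..} \<nu> (norm w / r) * inverse (norm w) \<ge> 0"
    using growth_rate_inv(2)[OF assms(1)] assms(4) by simp
  ultimately show ?thesis
    using assms by (simp add: cone_def)
qed

text \<open>For \<open>w = 0\<close> the control is constantly 0 because \<open>sgn 0 = 0\<close>.
  Otherwise \<open>norm w / w0\<close> is positive, where the inverse growth rate is
  continuous.\<close>

lemma tendsto_ctrl:
  assumes "growth_rate \<nu>" and "w0 > 0"
  shows "(ctrl \<nu> w \<longlongrightarrow> ctrl \<nu> w w0) (at_right w0)"
proof (cases "w = 0")
  case False
  then have "norm w / w0 \<in> {0<..}" using assms(2) by simp
  then have "isCont (inv_into {0..} \<nu>) (norm w / w0)"
    using continuous_on_growth_rate_inv[OF assms(1)]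
    by (simp add: continuous_on_eq_continuous_at)
  moreover have "((\<lambda>r. norm w / r) \<longlongrightarrow> norm w / w0) (at_right w0)"
    using assms(2) by (auto intro!: tendsto_intros)
  ultimately have "((\<lambda>r. inv_into {0..} \<nu> (norm w / r)) \<longlongrightarrow> inv_into {0..} \<nu> (norm w / w0))
      (at_right w0)"
    by (rule isCont_tendsto_compose)
  then show ?thesis
    unfolding ctrl_def by (intro tendsto_intros)
qed (simp add: ctrl_def[abs_def])

text \<open>For \<open>w0 > 0\<close> the control itself converges as \<open>r\<close> decreases to
  \<open>w0\<close>, so continuity in the control turns the limit into an evaluation.\<close>

lemma ext_int_eq_rescaled:
  assumes "growth_rate \<nu>" and "cone U" and "continuous_on U (rescaled \<nu> f x)"
    and "(w0, w) \<in> ext_controls U"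
  shows "ext_int \<nu> f x (w0, w) = rescaled \<nu> f x (ctrl \<nu> w w0)"
proof -
  have w0: "w0 > 0" and w: "w \<in> U"
    using assms(4) by (auto simp: ext_controls_def)
  have "((\<lambda>r. rescaled \<nu> f x (ctrl \<nu> w r)) \<longlongrightarrow> rescaled \<nu> f x (ctrl \<nu> w w0)) (at_right w0)"
  \<comment> \<open>Continuity is available only on \<open>U\<close>, so the approximating controls
    and their limit must stay there; the cone property ensures this.\<close>
  proof (rule continuous_on_tendsto_compose[OF assms(3) tendsto_ctrl[OF assms(1) w0]])
    show "ctrl \<nu> w w0 \<in> U"
      by (rule ctrl_in_cone[OF assms(1,2) w w0])
    show "\<forall>\<^sub>F r in at_right w0. ctrl \<nu> w r \<in> U"
      using eventually_at_right_less[of w0]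
      by eventually_elim (use ctrl_in_cone[OF assms(1,2) w] w0 in simp)
  qed
  then show ?thesis
    by (simp add: ext_int_def tendsto_Lim)
qed

lemma ctrl_image_ext_controls:
  assumes "growth_rate \<nu>" and "cone U"
  shows "(\<lambda>(w0, w). ctrl \<nu> w w0) ` ext_controls U = U"
proof
  show "(\<lambda>(w0, w). ctrl \<nu> w w0) ` ext_controls U \<subseteq> U"
    using ctrl_in_cone[OF assms] by (auto simp: ext_controls_def)
  show "U \<subseteq> (\<lambda>(w0, w). ctrl \<nu> w w0) ` ext_controls U"
  proof
    fix u assume u: "u \<in> U"
    \<comment> \<open>The preimage of \<open>u\<close> solves
      \<open>norm w / w0 = \<nu> (norm u)\<close> together with \<open>w0 + norm w = 1\<close>, with
      \<open>w\<close> in the direction of \<open>u\<close>.\<close>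
    define s where "s = \<nu> (norm u)"
    define w0 where "w0 = 1 / (1 + s)"
    define w where "w = (s / (1 + s)) *\<^sub>R sgn u"
    have s: "s \<ge> 0"
      using growth_rate_inv(5)[OF assms(1)] by (simp add: s_def)
    \<comment> \<open>This keeps the formula for \<open>norm w\<close> valid when
      \<open>sgn u = 0\<close>.\<close>
    have s0: "s = 0 \<longleftrightarrow> u = 0"
      using growth_rate_zero[OF assms(1)] growth_rate_inv(1)[OF assms(1)]
        growth_rate_inv(4)[OF assms(1), of "norm u"]
      by (auto simp: s_def)
    have norm_w: "norm w = s / (1 + s)"
      using s s0 by (auto simp: w_def norm_sgn)
    have "w = (s / (1 + s) * inverse (norm u)) *\<^sub>R u"
      by (simp add: w_def sgn_div_norm)
    moreover have "s / (1 + s) * inverse (norm u) \<ge> 0"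
      using s by simp
    ultimately have "w \<in> U"
      using assms(2) u by (simp add: cone_def)
    then have "(w0, w) \<in> ext_controls U"
      using s norm_w by (simp add: ext_controls_def w0_def add_divide_distrib[symmetric])
    moreover have "ctrl \<nu> w w0 = u"
    proof -
      have "norm w / w0 = s"
        using s by (simp add: norm_w w0_def)
      then have "inv_into {0..} \<nu> (norm w / w0) = norm u"
        using growth_rate_inv(4)[OF assms(1)] by (simp add: s_def)
      moreover have "sgn w = sgn u"
        using s s0 by (auto simp: w_def sgn_scaleR sgn_div_norm[of "sgn u"] norm_sgn)
      ultimately show ?thesis
        by (cases "u = 0") (simp_all add: ctrl_def sgn_div_norm)
    qed
    ultimately show "u \<in> (\<lambda>(w0, w). ctrl \<nu> w w0) ` ext_controls U"
      by force
  qed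
qed

text \<open>A lower bound on a set survives passage to its closure: the preimage of a closed
  half-line under a continuous map is closed.\<close>

lemma hamiltonian_closure:
  fixes V :: "'v::topological_space set"
  assumes "continuous_on (closure V) (g x)"
  shows "hamiltonian g (closure V) x p = hamiltonian g V x p"
proof (rule antisym)
  show "hamiltonian g (closure V) x p \<le> hamiltonian g V x p"
    unfolding hamiltonian_def by (rule INF_superset_mono) (auto simp: closure_subset)
  have "(\<lambda>v. ereal (p \<bullet> g x v)) ` closure V \<subseteq> {hamiltonian g V x p..}"
  proof (rule image_closure_subset)
    show "continuous_on (closure V) (\<lambda>v. ereal (p \<bullet> g x v))"
      using assms by (intro continuous_on_ereal continuous_intros)
    show "(\<lambda>v. ereal (p \<bullet> g x v)) ` V \<subseteq> {hamiltonian g V x p..}"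
      by (auto simp: hamiltonian_def intro: INF_lower)
  qed simp
  then show "hamiltonian g V x p \<le> hamiltonian g (closure V) x p"
    by (auto simp: hamiltonian_def[of g "closure V"] intro!: INF_greatest)
qed

text \<open>Limit controls drop out of the infimum by continuity of \<open>ext_dyn\<close>; the
  remaining ones are reindexed by the surjection onto \<open>U\<close>.\<close>

lemma hamiltonian_ext_dyn:
  assumes "cone U" and "Hg C U \<nu> f" and x: "x \<in> - C"
  shows "hamiltonian (ext_dyn C \<nu> f) (closure (ext_controls U)) x p =
         hamiltonian (rescaled \<nu> f) U x p"
proof -
  have \<nu>: "growth_rate \<nu>"
    and unif: "\<And>K. compact K \<Longrightarrow> K \<subseteq> - C \<Longrightarrow>
      uniformly_continuous_on (K \<times> U) (\<lambda>(x, u). rescaled \<nu> f x u)"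
    and contF: "continuous_on (closure (- C) \<times> closure (ext_controls U))
      (\<lambda>(x, \<omega>). ext_dyn C \<nu> f x \<omega>)"
    using assms(2) by (auto simp: Hg_def)
  \<comment> \<open>The singleton \<open>{x}\<close> is a compact subset of \<open>- C\<close>, so
    \<open>Hg\<close> gives continuity in the control at a fixed state.\<close>
  have "continuous_on ({x} \<times> U) (\<lambda>(x, u). rescaled \<nu> f x u)"
    using unif[of "{x}"] x by (intro uniformly_continuous_imp_continuous) auto
  from continuous_on_compose2[OF this, of U "Pair x"]
  have cont: "continuous_on U (rescaled \<nu> f x)"
    by (simp add: continuous_on_Pair image_subset_iff)
  have "x \<in> closure (- C)"
    using x closure_subset by blast
  with continuous_on_compose2[OF contF, of "closure (ext_controls U)" "Pair x"]
  have "continuous_on (closure (ext_controls U)) (ext_dyn C \<nu> f x)"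
    by (simp add: continuous_on_Pair image_subset_iff)
  then have "hamiltonian (ext_dyn C \<nu> f) (closure (ext_controls U)) x p =
      hamiltonian (ext_dyn C \<nu> f) (ext_controls U) x p"
    by (rule hamiltonian_closure)
  \<comment> \<open>Since \<open>x\<close> lies in \<open>- C\<close>, \<open>ext_dyn\<close> takes
    its \<open>ext_int\<close> branch, and every control here has \<open>w0 > 0\<close>.\<close>
  also have "\<dots> = (INF \<omega>\<in>ext_controls U.
      ereal (p \<bullet> rescaled \<nu> f x (case \<omega> of (w0, w) \<Rightarrow> ctrl \<nu> w w0)))"
    unfolding hamiltonian_def
    by (rule INF_cong)
      (use x ext_int_eq_rescaled[OF \<nu> assms(1) cont] in \<open>auto simp: ext_dyn_def\<close>)
  also have "\<dots> = (INF u\<in>(\<lambda>(w0, w). ctrl \<nu> w w0) ` ext_controls U.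
      ereal (p \<bullet> rescaled \<nu> f x u))"
    by (simp add: image_image)
  also have "\<dots> = hamiltonian (rescaled \<nu> f) U x p"
    unfolding ctrl_image_ext_controls[OF \<nu> assms(1)] hamiltonian_def ..
  finally show ?thesis .
qed

theorem proposition4p1:
  fixes C :: "(real ^ 'n) set" and U :: "(real ^ 'm) set"
    and f :: "real ^ 'n \<Rightarrow> real ^ 'm \<Rightarrow> real ^ 'n"
    and \<nu> :: "real \<Rightarrow> real"
    and W :: "real ^ 'n \<Rightarrow> real"
  assumes "C \<noteq> {}" and "closed C" and "compact (frontier C)"
    and "U \<noteq> {}" and "closed U" and "cone U"
    and "continuous_on ((- C) \<times> U) (\<lambda>(x, u). f x u)"
    and "Hg C U \<nu> f"
    and "W \<in> closure (- C) \<rightarrow> {0..}"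
  shows "is_CLF C (rescaled \<nu> f) U W \<longleftrightarrow>
         is_CLF C (ext_dyn C \<nu> f) (closure (ext_controls U)) W"
proof -
  \<comment> \<open>Equality of the Hamiltonians lets the same \<open>\<gamma>\<close> serve both
    systems, strict inequality included.\<close>
  have "(\<forall>x\<in>- C. \<forall>p\<in>lim_subdiff C W x.
          hamiltonian (rescaled \<nu> f) U x p < ereal (- \<gamma> (W x))) \<longleftrightarrow>
        (\<forall>x\<in>- C. \<forall>p\<in>lim_subdiff C W x.
          hamiltonian (ext_dyn C \<nu> f) (closure (ext_controls U)) x p < ereal (- \<gamma> (W x)))" for \<gamma>
    by (intro ball_cong refl)
      (simp only: hamiltonian_ext_dyn[OF \<open>cone U\<close> \<open>Hg C U \<nu> f\<close>])
  then show ?thesis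
    unfolding is_CLF_def by (simp only:)
qed

end
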